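(* Let $(M,g)$ be a light-like manifold of nullity degree $1$, such that the line bundle $Rad(TM)$ is trivial. Let $\xi\in\Gamma(Rad(TM))$ be a nowhere vanishing section and let $\tau\in\Gamma(T^{*}M)$ be a smooth 1-form with $\tau(\xi)=1$ at every point of $M$. Let $\bar g:=g+\tau\otimes\tau$, which is a non-degenerate symmetric $(0,2)$-tensor field, so that $(M,\bar g)$ is a semi-Riemannian manifold. Then: i) If $\nabla$ is a torsion-free linear connection on $M$ with $\nabla_X g=0$ and $\nabla_X\tau=0$ for all $X\in\Gamma(TM)$, then $L_\xi g=0$, $d\tau=0$, and $\nabla$ is the Levi-Civita connection of $(M,\bar g)$. ii) Assume $L_\xi g=0$ and $d\tau=0$. If $\nabla$ is the Levi-Civita connection of $(M,\bar g)$, then $\nabla_X g=0$ and $\nabla_X\tau=0$ for all $X\in\Gamma(TM)$.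
   Context: A light-like manifold $(M,g)$ is a smooth manifold $M$ with a smooth symmetric $(0,2)$-tensor field $g$ of constant index and constant nullity degree (co-rank). $Rad(TM)$ is the radical of $g$: the subbundle of $TM$ with fibres $Rad(T_xM)=\{v\in T_xM : g(v,w)=0 \text{ for all } w\in T_xM\}$; its rank equals the nullity degree. $\Gamma(E)$ denotes the space of smooth sections of a bundle $E$. $L$ denotes the Lie derivative. Conventions: $(d\tau)(X,Y)=X\tau(Y)-Y\tau(X)-\tau([X,Y])$, $(\nabla_Xg)(Y,Z)=X(g(Y,Z))-g(\nabla_XY,Z)-g(Y,\nabla_XZ)$, $(\nabla_X\tau)(Y)=X(\tau(Y))-\tau(\nabla_XY)$, $(L_\xi g)(Y,Z)=\xi(g(Y,Z))-g([\xi,Y],Z)-g(Y,[\xi,Z])$. *)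

theory Defs
  imports "HOL-Analysis.Analysis" "HOL-Library.Function_Algebras"
begin

text \<open>
  Real-valued functions with pointwise operations form a real vector space; tangent vectors
  (derivations) live in such spaces, so that \<^const>\<open>subspace\<close> and \<^const>\<open>dim\<close> apply to them.
\<close>

instantiation "fun" :: (type, real_vector) real_vector
begin

definition scaleR_fun :: "real \<Rightarrow> ('a \<Rightarrow> 'b) \<Rightarrow> 'a \<Rightarrow> 'b"
  where "scaleR_fun r f = (\<lambda>x. r *\<^sub>R f x)"

instance
  by standard (auto simp: scaleR_fun_def plus_fun_def scaleR_add_right scaleR_add_left)

end


section \<open>Smooth manifolds\<close>

text \<open>These notions are only used for open \<open>S\<close>, hence the unrestricted \<^term>\<open>at x\<close>.\<close>

primrec Ck_on :: "nat \<Rightarrow> ('e::real_normed_vector \<Rightarrow> 'f::real_normed_vector) \<Rightarrow> 'e set \<Rightarrow> bool" where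
  "Ck_on 0 f S \<longleftrightarrow> continuous_on S f"
| "Ck_on (Suc k) f S \<longleftrightarrow> (\<forall>x\<in>S. f differentiable (at x)) \<and>
     (\<forall>v. Ck_on k (\<lambda>x. frechet_derivative f (at x) v) S)"

definition smooth_on :: "'e::real_normed_vector set \<Rightarrow> ('e \<Rightarrow> 'f::real_normed_vector) \<Rightarrow> bool"
  where "smooth_on S f \<longleftrightarrow> (\<forall>k. Ck_on k f S)"

text \<open>
  A manifold is a whole type \<^typ>\<open>'a\<close> (Hausdorff and second countable) together with an atlas of
  charts \<open>(U, \<phi>)\<close> with values in a Euclidean space \<^typ>\<open>'e\<close>. The values of \<open>\<phi>\<close> outside \<open>U\<close> are
  irrelevant, and the atlas need not be maximal.
\<close>

type_synonym ('a, 'e) chart = "'a set \<times> ('a \<Rightarrow> 'e)"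

definition is_chart :: "('a::topological_space, 'e::euclidean_space) chart \<Rightarrow> bool"
  where "is_chart = (\<lambda>(U, \<phi>). open U \<and> open (\<phi> ` U) \<and> homeomorphism U (\<phi> ` U) \<phi> (inv_into U \<phi>))"

definition smooth_manifold ::
    "('a::{t2_space, second_countable_topology}, 'e::euclidean_space) chart set \<Rightarrow> bool"
  where "smooth_manifold A \<longleftrightarrow>
    (\<forall>c\<in>A. is_chart c) \<and>
    (\<Union>(U, \<phi>)\<in>A. U) = UNIV \<and>
    (\<forall>(U, \<phi>)\<in>A. \<forall>(V, \<psi>)\<in>A. smooth_on (\<phi> ` (U \<inter> V)) (\<psi> \<circ> inv_into U \<phi>))"

definition smooth_function :: "('a::topological_space, 'e::euclidean_space) chart set \<Rightarrow> ('a \<Rightarrow> real) \<Rightarrow> bool"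
  where "smooth_function A f \<longleftrightarrow> (\<forall>(U, \<phi>)\<in>A. smooth_on (\<phi> ` U) (f \<circ> inv_into U \<phi>))"


section \<open>Tangent vectors and vector fields\<close>

text \<open>
  Tangent vectors at \<open>x\<close> are the derivations at \<open>x\<close> of the algebra of smooth functions. Since HOL
  functions are total, a tangent vector is required to vanish on non-smooth functions; otherwise
  \<open>tangent_space A x\<close> would not have dimension \<open>DIM('e)\<close>.
\<close>

type_synonym 'a tvec = "('a \<Rightarrow> real) \<Rightarrow> real"

definition tangent_space :: "('a::topological_space, 'e::euclidean_space) chart set \<Rightarrow> 'a \<Rightarrow> 'a tvec set"
  where "tangent_space A x = {v.
    (\<forall>f. \<not> smooth_function A f \<longrightarrow> v f = 0) \<and>
    (\<forall>f h. smooth_function A f \<longrightarrow> smooth_function A h \<longrightarrow> v (\<lambda>q. f q + h q) = v f + v h) \<and>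
    (\<forall>c f. smooth_function A f \<longrightarrow> v (\<lambda>q. c * f q) = c * v f) \<and>
    (\<forall>f h. smooth_function A f \<longrightarrow> smooth_function A h \<longrightarrow>
       v (\<lambda>q. f q * h q) = f x * v h + h x * v f)}"

type_synonym 'a vfield = "'a \<Rightarrow> 'a tvec"

definition vapply :: "'a vfield \<Rightarrow> ('a \<Rightarrow> real) \<Rightarrow> 'a \<Rightarrow> real"
  where "vapply X f = (\<lambda>p. X p f)"

definition vector_fields :: "('a::topological_space, 'e::euclidean_space) chart set \<Rightarrow> 'a vfield set"
  where "vector_fields A = {X.
    (\<forall>p. X p \<in> tangent_space A p) \<and>
    (\<forall>f. smooth_function A f \<longrightarrow> smooth_function A (vapply X f))}"

definition lie_bracket ::
    "('a::topological_space, 'e::euclidean_space) chart set \<Rightarrow> 'a vfield \<Rightarrow> 'a vfield \<Rightarrow> 'a vfield"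
  where "lie_bracket A X Y = (\<lambda>p f.
    if smooth_function A f then vapply X (vapply Y f) p - vapply Y (vapply X f) p else 0)"


section \<open>Smooth covariant tensor fields\<close>

text \<open>
  The values of tensor fields on arguments outside the tangent spaces are irrelevant. A pointwise
  multilinear field is smooth if it yields smooth functions when applied to smooth vector fields.
\<close>

definition one_form ::
    "('a::topological_space, 'e::euclidean_space) chart set \<Rightarrow> ('a \<Rightarrow> 'a tvec \<Rightarrow> real) \<Rightarrow> bool"
  where "one_form A \<tau> \<longleftrightarrow>
    (\<forall>p. \<forall>v\<in>tangent_space A p. \<forall>w\<in>tangent_space A p. \<tau> p (v + w) = \<tau> p v + \<tau> p w) \<and>
    (\<forall>p. \<forall>c. \<forall>v\<in>tangent_space A p. \<tau> p (c *\<^sub>R v) = c * \<tau> p v) \<and>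
    (\<forall>X\<in>vector_fields A. smooth_function A (\<lambda>p. \<tau> p (X p)))"

definition symmetric_tensor ::
    "('a::topological_space, 'e::euclidean_space) chart set \<Rightarrow> ('a \<Rightarrow> 'a tvec \<Rightarrow> 'a tvec \<Rightarrow> real) \<Rightarrow> bool"
  where "symmetric_tensor A g \<longleftrightarrow>
    (\<forall>p. \<forall>v\<in>tangent_space A p. \<forall>w\<in>tangent_space A p. g p v w = g p w v) \<and>
    (\<forall>p. \<forall>u\<in>tangent_space A p. \<forall>v\<in>tangent_space A p. \<forall>w\<in>tangent_space A p.
       g p (u + v) w = g p u w + g p v w) \<and>
    (\<forall>p. \<forall>c. \<forall>v\<in>tangent_space A p. \<forall>w\<in>tangent_space A p. g p (c *\<^sub>R v) w = c * g p v w) \<and>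
    (\<forall>X\<in>vector_fields A. \<forall>Y\<in>vector_fields A. smooth_function A (\<lambda>p. g p (X p) (Y p)))"

definition radical ::
    "('a::topological_space, 'e::euclidean_space) chart set \<Rightarrow> ('a \<Rightarrow> 'a tvec \<Rightarrow> 'a tvec \<Rightarrow> real)
     \<Rightarrow> 'a \<Rightarrow> 'a tvec set"
  where "radical A g x = {v \<in> tangent_space A x. \<forall>w\<in>tangent_space A x. g x v w = 0}"

definition nullity_degree ::
    "('a::topological_space, 'e::euclidean_space) chart set \<Rightarrow> ('a \<Rightarrow> 'a tvec \<Rightarrow> 'a tvec \<Rightarrow> real)
     \<Rightarrow> 'a \<Rightarrow> nat"
  where "nullity_degree A g x = dim (radical A g x)"

definition index ::
    "('a::topological_space, 'e::euclidean_space) chart set \<Rightarrow> ('a \<Rightarrow> 'a tvec \<Rightarrow> 'a tvec \<Rightarrow> real)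
     \<Rightarrow> 'a \<Rightarrow> nat"
  where "index A g x =
    Max {dim N |N. subspace N \<and> N \<subseteq> tangent_space A x \<and> (\<forall>v\<in>N. v \<noteq> 0 \<longrightarrow> g x v v < 0)}"

definition lightlike_manifold ::
    "('a::{t2_space, second_countable_topology}, 'e::euclidean_space) chart set
     \<Rightarrow> ('a \<Rightarrow> 'a tvec \<Rightarrow> 'a tvec \<Rightarrow> real) \<Rightarrow> bool"
  where "lightlike_manifold A g \<longleftrightarrow>
    smooth_manifold A \<and> symmetric_tensor A g \<and>
    (\<exists>\<nu>. \<forall>x. index A g x = \<nu>) \<and> (\<exists>r. \<forall>x. nullity_degree A g x = r)"

definition nondegenerate ::
    "('a::topological_space, 'e::euclidean_space) chart set \<Rightarrow> ('a \<Rightarrow> 'a tvec \<Rightarrow> 'a tvec \<Rightarrow> real) \<Rightarrow> bool"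
  where "nondegenerate A h \<longleftrightarrow>
    (\<forall>x. \<forall>v\<in>tangent_space A x. (\<forall>w\<in>tangent_space A x. h x v w = 0) \<longrightarrow> v = 0)"

definition semi_riemannian_manifold ::
    "('a::{t2_space, second_countable_topology}, 'e::euclidean_space) chart set
     \<Rightarrow> ('a \<Rightarrow> 'a tvec \<Rightarrow> 'a tvec \<Rightarrow> real) \<Rightarrow> bool"
  where "semi_riemannian_manifold A h \<longleftrightarrow>
    smooth_manifold A \<and> symmetric_tensor A h \<and> nondegenerate A h \<and> (\<exists>\<nu>. \<forall>x. index A h x = \<nu>)"

definition radical_sections ::
    "('a::topological_space, 'e::euclidean_space) chart set \<Rightarrow> ('a \<Rightarrow> 'a tvec \<Rightarrow> 'a tvec \<Rightarrow> real)
     \<Rightarrow> 'a vfield set"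
  where "radical_sections A g = {X \<in> vector_fields A. \<forall>p. X p \<in> radical A g p}"

text \<open>
  Triviality of the radical as a line bundle: there is a fibrewise linear bijection \<open>\<Phi>\<close> from
  \<open>M \<times> \<real>\<close> to the radical bundle which, together with its inverse, maps smooth sections to smooth
  sections.
\<close>

definition trivial_radical_line_bundle ::
    "('a::topological_space, 'e::euclidean_space) chart set \<Rightarrow> ('a \<Rightarrow> 'a tvec \<Rightarrow> 'a tvec \<Rightarrow> real) \<Rightarrow> bool"
  where "trivial_radical_line_bundle A g \<longleftrightarrow> (\<exists>\<Phi> :: 'a \<Rightarrow> real \<Rightarrow> 'a tvec.
    (\<forall>p. linear (\<Phi> p) \<and> bij_betw (\<Phi> p) UNIV (radical A g p)) \<and>
    (\<forall>f. smooth_function A f \<longrightarrow> (\<lambda>p. \<Phi> p (f p)) \<in> radical_sections A g) \<and>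
    (\<forall>X\<in>radical_sections A g. smooth_function A (\<lambda>p. inv (\<Phi> p) (X p))))"

text \<open>The tensor field \<open>g + \<tau> \<otimes> \<tau>\<close>.\<close>

definition bar_metric ::
    "('a \<Rightarrow> 'a tvec \<Rightarrow> 'a tvec \<Rightarrow> real) \<Rightarrow> ('a \<Rightarrow> 'a tvec \<Rightarrow> real) \<Rightarrow> 'a \<Rightarrow> 'a tvec \<Rightarrow> 'a tvec \<Rightarrow> real"
  where "bar_metric g \<tau> = (\<lambda>p v w. g p v w + \<tau> p v * \<tau> p w)"

definition lie_derivative ::
    "('a::topological_space, 'e::euclidean_space) chart set \<Rightarrow> 'a vfield
     \<Rightarrow> ('a \<Rightarrow> 'a tvec \<Rightarrow> 'a tvec \<Rightarrow> real) \<Rightarrow> 'a vfield \<Rightarrow> 'a vfield \<Rightarrow> 'a \<Rightarrow> real"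
  where "lie_derivative A \<xi> g Y Z = (\<lambda>p.
    vapply \<xi> (\<lambda>q. g q (Y q) (Z q)) p
    - g p (lie_bracket A \<xi> Y p) (Z p) - g p (Y p) (lie_bracket A \<xi> Z p))"

definition ext_deriv ::
    "('a::topological_space, 'e::euclidean_space) chart set \<Rightarrow> ('a \<Rightarrow> 'a tvec \<Rightarrow> real)
     \<Rightarrow> 'a vfield \<Rightarrow> 'a vfield \<Rightarrow> 'a \<Rightarrow> real"
  where "ext_deriv A \<tau> X Y = (\<lambda>p.
    vapply X (\<lambda>q. \<tau> q (Y q)) p - vapply Y (\<lambda>q. \<tau> q (X q)) p - \<tau> p (lie_bracket A X Y p))"


section \<open>Linear connections\<close>

type_synonym 'a connection = "'a vfield \<Rightarrow> 'a vfield \<Rightarrow> 'a vfield"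

definition linear_connection ::
    "('a::topological_space, 'e::euclidean_space) chart set \<Rightarrow> 'a connection \<Rightarrow> bool"
  where "linear_connection A nab \<longleftrightarrow>
    (\<forall>X\<in>vector_fields A. \<forall>Y\<in>vector_fields A. nab X Y \<in> vector_fields A) \<and>
    (\<forall>X\<in>vector_fields A. \<forall>Y\<in>vector_fields A. \<forall>Z\<in>vector_fields A.
       nab (X + Y) Z = nab X Z + nab Y Z) \<and>
    (\<forall>f. \<forall>X\<in>vector_fields A. \<forall>Y\<in>vector_fields A. smooth_function A f \<longrightarrow>
       nab (\<lambda>p. f p *\<^sub>R X p) Y = (\<lambda>p. f p *\<^sub>R nab X Y p)) \<and>
    (\<forall>X\<in>vector_fields A. \<forall>Y\<in>vector_fields A. \<forall>Z\<in>vector_fields A.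
       nab X (Y + Z) = nab X Y + nab X Z) \<and>
    (\<forall>f. \<forall>X\<in>vector_fields A. \<forall>Y\<in>vector_fields A. smooth_function A f \<longrightarrow>
       nab X (\<lambda>p. f p *\<^sub>R Y p) = (\<lambda>p. vapply X f p *\<^sub>R Y p + f p *\<^sub>R nab X Y p))"

definition torsion_free ::
    "('a::topological_space, 'e::euclidean_space) chart set \<Rightarrow> 'a connection \<Rightarrow> bool"
  where "torsion_free A nab \<longleftrightarrow>
    (\<forall>X\<in>vector_fields A. \<forall>Y\<in>vector_fields A. nab X Y - nab Y X = lie_bracket A X Y)"

definition cov_deriv_tensor ::
    "'a connection \<Rightarrow> 'a vfield \<Rightarrow> ('a \<Rightarrow> 'a tvec \<Rightarrow> 'a tvec \<Rightarrow> real) \<Rightarrow> 'a vfield \<Rightarrow> 'a vfield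
     \<Rightarrow> 'a \<Rightarrow> real"
  where "cov_deriv_tensor nab X g Y Z = (\<lambda>p.
    vapply X (\<lambda>q. g q (Y q) (Z q)) p - g p (nab X Y p) (Z p) - g p (Y p) (nab X Z p))"

definition cov_deriv_form ::
    "'a connection \<Rightarrow> 'a vfield \<Rightarrow> ('a \<Rightarrow> 'a tvec \<Rightarrow> real) \<Rightarrow> 'a vfield \<Rightarrow> 'a \<Rightarrow> real"
  where "cov_deriv_form nab X \<tau> Y = (\<lambda>p. vapply X (\<lambda>q. \<tau> q (Y q)) p - \<tau> p (nab X Y p))"

definition parallel_tensor ::
    "('a::topological_space, 'e::euclidean_space) chart set \<Rightarrow> 'a connection
     \<Rightarrow> ('a \<Rightarrow> 'a tvec \<Rightarrow> 'a tvec \<Rightarrow> real) \<Rightarrow> bool"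
  where "parallel_tensor A nab g \<longleftrightarrow>
    (\<forall>X\<in>vector_fields A. \<forall>Y\<in>vector_fields A. \<forall>Z\<in>vector_fields A. \<forall>p. cov_deriv_tensor nab X g Y Z p = 0)"

definition parallel_form ::
    "('a::topological_space, 'e::euclidean_space) chart set \<Rightarrow> 'a connection
     \<Rightarrow> ('a \<Rightarrow> 'a tvec \<Rightarrow> real) \<Rightarrow> bool"
  where "parallel_form A nab \<tau> \<longleftrightarrow>
    (\<forall>X\<in>vector_fields A. \<forall>Y\<in>vector_fields A. \<forall>p. cov_deriv_form nab X \<tau> Y p = 0)"

definition levi_civita ::
    "('a::topological_space, 'e::euclidean_space) chart set
     \<Rightarrow> ('a \<Rightarrow> 'a tvec \<Rightarrow> 'a tvec \<Rightarrow> real) \<Rightarrow> 'a connection \<Rightarrow> bool"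
  where "levi_civita A h nab \<longleftrightarrow>
    linear_connection A nab \<and> torsion_free A nab \<and> parallel_tensor A nab h"

end

theory Submission
  imports Defs
begin

text \<open>
  The form \<open>\<tau>\<close> splits every tangent space as \<open>ker \<tau> \<oplus> \<real>\<xi>\<close>, because the radical is the line
  spanned by \<open>\<xi>\<close> and \<open>\<tau>(\<xi>) = 1\<close>. The metric \<open>g + \<tau> \<otimes> \<tau>\<close> agrees with \<open>g\<close> on \<open>ker \<tau>\<close>, where \<open>g\<close> is
  non-degenerate, and makes \<open>\<xi>\<close> a unit vector orthogonal to \<open>ker \<tau>\<close>. Hence it is non-degenerate, and
  as only a positive direction has been added, its index is that of \<open>g\<close>: projecting along \<open>\<xi>\<close> moves
  negative definite subspaces of \<open>g\<close> into \<open>ker \<tau>\<close> without changing their dimension.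

  The statements on connections rest on three tensor identities. For \<open>\<nabla>\<close> torsion-free,
  \<open>(L\<^sub>\<xi> h)(Y,Z) = (\<nabla>\<^sub>\<xi> h)(Y,Z) + h(\<nabla>\<^sub>Y \<xi>, Z) + h(Y, \<nabla>\<^sub>Z \<xi>)\<close> and
  \<open>d\<tau>(X,Y) = (\<nabla>\<^sub>X \<tau>)(Y) - (\<nabla>\<^sub>Y \<tau>)(X)\<close>; and \<open>\<nabla>\<^sub>X\<close> obeys the Leibniz rule on \<open>g + \<tau> \<otimes> \<tau>\<close>.
  If \<open>g\<close> and \<open>\<tau>\<close> are parallel, then \<open>g(\<nabla>\<^sub>Y \<xi>, Z) = Y(g(\<xi>,Z)) - g(\<xi>, \<nabla>\<^sub>Y Z) = 0\<close>, and the three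
  identities give the first part.

  Conversely, let \<open>\<nabla>\<close> be the Levi-Civita connection of \<open>h = g + \<tau> \<otimes> \<tau>\<close>. As \<open>\<tau> = h(\<xi>, -)\<close>, the
  bilinear form \<open>B(X,Y) = h(\<nabla>\<^sub>X \<xi>, Y)\<close> equals \<open>(\<nabla>\<^sub>X \<tau>)(Y)\<close>. It is symmetric because \<open>d\<tau> = 0\<close>. It is
  skew because \<open>\<xi>\<close> is a Killing field of \<open>h\<close>: by Cartan's formula
  \<open>L\<^sub>\<xi> \<tau> = d(\<tau>(\<xi>)) + d\<tau>(\<xi>, -) = 0\<close>, so \<open>L\<^sub>\<xi> h = L\<^sub>\<xi> g = 0\<close>. Therefore \<open>B = 0\<close>, that is \<open>\<nabla>\<tau> = 0\<close>, and
  the Leibniz rule yields \<open>\<nabla>g = 0\<close>.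
\<close>

section \<open>The algebra of smooth functions\<close>

lemma Ck_on_cong:
  assumes "open S" and "Ck_on k f S" and "\<And>x. x \<in> S \<Longrightarrow> f x = h x"
  shows "Ck_on k h S"
  using assms(2,3)
proof (induction k arbitrary: f h)
  case 0
  then show ?case by (simp cong: continuous_on_cong)
next
  case (Suc k)
  have diff: "h differentiable (at x)" if "x \<in> S" for x
  proof -
    have "f differentiable (at x)" using Suc.prems(1) that by simp
    then obtain D where "(f has_derivative D) (at x)"
      unfolding differentiable_def by blast
    then have "(h has_derivative D) (at x)"
      by (rule has_derivative_transform_within_open[OF _ assms(1) that Suc.prems(2)])
    then show ?thesis by (rule differentiableI)
  qed
  have deriv: "frechet_derivative f (at x) v = frechet_derivative h (at x) v" if "x \<in> S" for x v
    using frechet_derivative_transform_within_open[of f x S h] Suc.prems that assms(1) by simp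
  have "Ck_on k (\<lambda>x. frechet_derivative h (at x) v) S" for v
    by (rule Suc.IH[where f = "\<lambda>x. frechet_derivative f (at x) v"]) (use Suc.prems deriv in auto)
  with diff show ?case by simp
qed

lemma Ck_on_SucD: "Ck_on (Suc k) f S \<Longrightarrow> Ck_on k f S"
proof (induction k arbitrary: f)
  case 0
  then show ?case
    by (auto intro!: continuous_at_imp_continuous_on differentiable_imp_continuous_within)
next
  case (Suc k)
  have "Ck_on k (\<lambda>x. frechet_derivative f (at x) v) S" for v
    by (rule Suc.IH) (use Suc.prems in simp)
  with Suc.prems show ?case by simp
qed

lemma Ck_on_add:
  assumes "open S" and "Ck_on k f S" and "Ck_on k h S"
  shows "Ck_on k (\<lambda>x. f x + h x) S"
  using assms(2,3)
proof (induction k arbitrary: f h)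
  case 0
  then show ?case by (simp add: continuous_on_add)
next
  case (Suc k)
  have deriv: "((\<lambda>x. f x + h x) has_derivative
      (\<lambda>v. frechet_derivative f (at x) v + frechet_derivative h (at x) v)) (at x)" if "x \<in> S" for x
    using Suc.prems that by (auto intro!: has_derivative_add simp: frechet_derivative_works[symmetric])
  have "Ck_on k (\<lambda>x. frechet_derivative (\<lambda>x. f x + h x) (at x) v) S" for v
  proof (rule Ck_on_cong[OF assms(1)])
    show "Ck_on k (\<lambda>x. frechet_derivative f (at x) v + frechet_derivative h (at x) v) S"
      by (rule Suc.IH) (use Suc.prems in simp_all)
  qed (simp add: frechet_derivative_at[OF deriv, symmetric])
  with deriv show ?case by (auto simp: differentiable_def)
qed

lemma Ck_on_mult:
  fixes f h :: "'e::real_normed_vector \<Rightarrow> real"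
  assumes "open S" and "Ck_on k f S" and "Ck_on k h S"
  shows "Ck_on k (\<lambda>x. f x * h x) S"
  using assms(2,3)
proof (induction k arbitrary: f h)
  case 0
  then show ?case by (simp add: continuous_on_mult)
next
  case (Suc k)
  have deriv: "((\<lambda>x. f x * h x) has_derivative
      (\<lambda>v. f x * frechet_derivative h (at x) v + frechet_derivative f (at x) v * h x)) (at x)"
    if "x \<in> S" for x
    using Suc.prems that by (auto intro!: has_derivative_mult simp: frechet_derivative_works[symmetric])
  have "Ck_on k (\<lambda>x. frechet_derivative (\<lambda>x. f x * h x) (at x) v) S" for v
  proof (rule Ck_on_cong[OF assms(1)])
    show "Ck_on k (\<lambda>x. f x * frechet_derivative h (at x) v + frechet_derivative f (at x) v * h x) S"
      by (intro Ck_on_add[OF assms(1)] Suc.IH Ck_on_SucD[OF Suc.prems(1)] Ck_on_SucD[OF Suc.prems(2)])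
        (use Suc.prems in simp_all)
  qed (simp add: frechet_derivative_at[OF deriv, symmetric])
  with deriv show ?case by (auto simp: differentiable_def)
qed

lemma chart_image_open: "smooth_manifold A \<Longrightarrow> (U, \<phi>) \<in> A \<Longrightarrow> open (\<phi> ` U)"
  by (auto simp: smooth_manifold_def is_chart_def)

lemma smooth_function_add:
  assumes "smooth_manifold A" "smooth_function A f" "smooth_function A h"
  shows "smooth_function A (\<lambda>p. f p + h p)"
  using assms(2,3) chart_image_open[OF assms(1)]
  by (fastforce simp: smooth_function_def smooth_on_def o_def intro!: Ck_on_add)

lemma smooth_function_mult:
  assumes "smooth_manifold A" "smooth_function A f" "smooth_function A h"
  shows "smooth_function A (\<lambda>p. f p * h p)"
  using assms(2,3) chart_image_open[OF assms(1)]
  by (fastforce simp: smooth_function_def smooth_on_def o_def intro!: Ck_on_mult)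


section \<open>Tangent vectors, one-forms and symmetric tensors\<close>

lemma subspace_tangent_space: "subspace (tangent_space A x)"
  by (rule subspaceI)
    (auto simp: tangent_space_def scaleR_fun_def algebra_simps)

lemma vector_field_at: "X \<in> vector_fields A \<Longrightarrow> X p \<in> tangent_space A p"
  by (simp add: vector_fields_def)

lemma vapply_add:
  assumes "X \<in> vector_fields A" "smooth_function A f" "smooth_function A h"
  shows "vapply X (\<lambda>q. f q + h q) p = vapply X f p + vapply X h p"
  using vector_field_at[OF assms(1), of p] assms(2,3) by (simp add: tangent_space_def vapply_def)

lemma vapply_mult:
  assumes "X \<in> vector_fields A" "smooth_function A f" "smooth_function A h"
  shows "vapply X (\<lambda>q. f q * h q) p = f p * vapply X h p + h p * vapply X f p"
  using vector_field_at[OF assms(1), of p] assms(2,3) by (simp add: tangent_space_def vapply_def)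

text \<open>
  Homogeneity gives \<open>v(0) = 0\<close>. For \<open>c \<noteq> 0\<close>, comparing the Leibniz rule with homogeneity on \<open>c \<cdot> c\<close>
  gives \<open>2 c v(c) = c v(c)\<close>.
\<close>
lemma vapply_const:
  assumes "X \<in> vector_fields A"
  shows "vapply X (\<lambda>_. c) p = 0"
proof (cases "smooth_function A (\<lambda>_. c)")
  case False
  then show ?thesis
    using vector_field_at[OF assms, of p] by (simp add: tangent_space_def vapply_def)
next
  case smooth: True
  have scale: "X p (\<lambda>q. a * c) = a * X p (\<lambda>_. c)" for a
    using vector_field_at[OF assms, of p] smooth by (simp add: tangent_space_def)
  show ?thesis
  proof (cases "c = 0")
    case True
    then show ?thesis using scale[of 0] by (simp add: vapply_def)
  next
    case False
    have "X p (\<lambda>q. c * c) = c * X p (\<lambda>_. c) + c * X p (\<lambda>_. c)"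
      using vapply_mult[OF assms smooth smooth, of p] by (simp add: vapply_def)
    then show ?thesis using scale[of c] False by (simp add: vapply_def)
  qed
qed

lemma one_form_add:
  "one_form A \<tau> \<Longrightarrow> v \<in> tangent_space A p \<Longrightarrow> w \<in> tangent_space A p \<Longrightarrow> \<tau> p (v + w) = \<tau> p v + \<tau> p w"
  by (simp add: one_form_def)

lemma one_form_scaleR:
  "one_form A \<tau> \<Longrightarrow> v \<in> tangent_space A p \<Longrightarrow> \<tau> p (c *\<^sub>R v) = c * \<tau> p v"
  by (simp add: one_form_def)

lemma one_form_smooth:
  "one_form A \<tau> \<Longrightarrow> X \<in> vector_fields A \<Longrightarrow> smooth_function A (\<lambda>p. \<tau> p (X p))"
  by (simp add: one_form_def)

lemma one_form_diff:
  assumes "one_form A \<tau>" "v \<in> tangent_space A p" "w \<in> tangent_space A p"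
  shows "\<tau> p (v - w) = \<tau> p v - \<tau> p w"
proof -
  have "(-1) *\<^sub>R w \<in> tangent_space A p"
    using assms(3) by (rule subspace_scale[OF subspace_tangent_space])
  then have "\<tau> p (v + (-1) *\<^sub>R w) = \<tau> p v + (-1) * \<tau> p w"
    using assms by (simp only: one_form_add one_form_scaleR)
  then show ?thesis by simp
qed

lemma symmetric_tensor_sym:
  "symmetric_tensor A h \<Longrightarrow> v \<in> tangent_space A p \<Longrightarrow> w \<in> tangent_space A p \<Longrightarrow> h p v w = h p w v"
  by (simp add: symmetric_tensor_def)

lemma symmetric_tensor_add:
  "symmetric_tensor A h \<Longrightarrow> u \<in> tangent_space A p \<Longrightarrow> v \<in> tangent_space A p \<Longrightarrow>
    w \<in> tangent_space A p \<Longrightarrow> h p (u + v) w = h p u w + h p v w"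
  by (simp add: symmetric_tensor_def)

lemma symmetric_tensor_scaleR:
  "symmetric_tensor A h \<Longrightarrow> v \<in> tangent_space A p \<Longrightarrow> w \<in> tangent_space A p \<Longrightarrow>
    h p (c *\<^sub>R v) w = c * h p v w"
  by (simp add: symmetric_tensor_def)

lemma symmetric_tensor_smooth:
  "symmetric_tensor A h \<Longrightarrow> X \<in> vector_fields A \<Longrightarrow> Y \<in> vector_fields A \<Longrightarrow>
    smooth_function A (\<lambda>p. h p (X p) (Y p))"
  by (simp add: symmetric_tensor_def)

lemma symmetric_tensor_diff:
  assumes "symmetric_tensor A h"
    and "u \<in> tangent_space A p" "v \<in> tangent_space A p" "w \<in> tangent_space A p"
  shows "h p (u - v) w = h p u w - h p v w"
proof -
  have "(-1) *\<^sub>R v \<in> tangent_space A p"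
    using assms(3) by (rule subspace_scale[OF subspace_tangent_space])
  then have "h p (u + (-1) *\<^sub>R v) w = h p u w + (-1) * h p v w"
    using assms by (simp only: symmetric_tensor_add symmetric_tensor_scaleR)
  then show ?thesis by simp
qed


section \<open>Non-degeneracy and index of the metric \<open>g + \<tau> \<otimes> \<tau>\<close>\<close>

lemma symmetric_tensor_bar_metric:
  assumes "smooth_manifold A" "symmetric_tensor A g" "one_form A \<tau>"
  shows "symmetric_tensor A (bar_metric g \<tau>)"
  unfolding symmetric_tensor_def bar_metric_def
  using assms
  by (auto intro!: smooth_function_add smooth_function_mult
      simp: symmetric_tensor_add symmetric_tensor_scaleR symmetric_tensor_smooth
        one_form_add one_form_scaleR one_form_smooth algebra_simps
      dest: symmetric_tensor_sym)

lemma dim_1_imp_multiple: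
  assumes "dim V = 1" and "u \<in> V" "u \<noteq> 0" "v \<in> V"
  obtains c where "v = c *\<^sub>R u"
proof -
  obtain B where B: "B \<subseteq> V" "independent B" "V \<subseteq> span B" "card B = 1"
    using basis_exists[of V] assms(1) by metis
  then obtain b where "B = {b}" by (auto simp: card_1_singleton_iff)
  with B(3) assms(2,4) have "u \<in> range (\<lambda>k. k *\<^sub>R b)" "v \<in> range (\<lambda>k. k *\<^sub>R b)"
    by (auto simp: span_singleton)
  then obtain s t where st: "u = s *\<^sub>R b" "v = t *\<^sub>R b" by blast
  with assms have "v = (t / s) *\<^sub>R u" by auto
  then show thesis by (rule that)
qed

text \<open>
  Pairing with \<open>\<xi>\<close> shows that a vector orthogonal to everything lies in \<open>ker \<tau>\<close>, hence in the radical
  of \<open>g\<close>, and the line spanned by \<open>\<xi>\<close> meets \<open>ker \<tau>\<close> only in \<open>0\<close>.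
\<close>
lemma nondegenerate_bar_metric:
  assumes "symmetric_tensor A g" "one_form A \<tau>"
    and "\<And>x. nullity_degree A g x = 1"
    and "\<And>x. \<xi> x \<in> radical A g x" "\<And>x. \<xi> x \<noteq> 0" "\<And>x. \<tau> x (\<xi> x) = 1"
  shows "nondegenerate A (bar_metric g \<tau>)"
  unfolding nondegenerate_def
proof (intro allI ballI impI)
  fix x v
  assume v: "v \<in> tangent_space A x" and null: "\<forall>w\<in>tangent_space A x. bar_metric g \<tau> x v w = 0"
  have xi: "\<xi> x \<in> tangent_space A x" "\<And>w. w \<in> tangent_space A x \<Longrightarrow> g x (\<xi> x) w = 0"
    using assms(4)[of x] by (auto simp: radical_def)
  have "g x v (\<xi> x) = 0"
    using symmetric_tensor_sym[OF assms(1) v xi(1)] xi(2)[OF v] by simp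
  with null xi(1) have tau_v: "\<tau> x v = 0"
    by (force simp: bar_metric_def assms(6))
  with null v have "v \<in> radical A g x"
    by (simp add: radical_def bar_metric_def)
  then obtain c where c: "v = c *\<^sub>R \<xi> x"
    using dim_1_imp_multiple[of "radical A g x" "\<xi> x" v] assms(3-5)
    unfolding nullity_degree_def by metis
  with tau_v have "c = 0"
    using one_form_scaleR[OF assms(2) xi(1), of c] assms(6)[of x] by simp
  with c show "v = 0" by simp
qed

text \<open>
  This is stated for maps that are linear merely on the subspace, since \<open>\<tau>\<close> is linear on tangent
  spaces only. Extending \<open>P\<close> linearly from a basis of \<open>N\<close> reduces it to globally linear maps.
\<close>
lemma dim_image_eq_on_subspace:
  fixes P :: "'v::real_vector \<Rightarrow> 'w::real_vector"
  assumes N: "subspace N"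
    and add: "\<And>u v. u \<in> N \<Longrightarrow> v \<in> N \<Longrightarrow> P (u + v) = P u + P v"
    and scale: "\<And>c v. v \<in> N \<Longrightarrow> P (c *\<^sub>R v) = c *\<^sub>R P v"
    and ker: "\<And>v. v \<in> N \<Longrightarrow> P v = 0 \<Longrightarrow> v = 0"
  shows "subspace (P ` N) \<and> dim (P ` N) = dim N"
proof -
  obtain B where B: "B \<subseteq> N" "independent B" "N \<subseteq> span B" "card B = dim N"
    using basis_exists[of N] by metis
  then have span_B: "span B = N"
    using N by (simp add: span_minimal subset_antisym)
  obtain f where f: "linear f" "\<And>b. b \<in> B \<Longrightarrow> f b = P b"
    using linear_independent_extend[OF B(2), of P] by blast
  have eq: "f v = P v" if "v \<in> N" for v
  proof -
    have "v \<in> span B" using that span_B by simp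
    then have "v \<in> N \<and> f v = P v"
    proof (induction rule: span_induct_alt)
      case base
      then show ?case using scale[of 0 0] N by (simp add: linear_0[OF f(1)] subspace_0)
    next
      case (step c x y)
      then show ?case
        using B(1) N f by (auto simp: add scale subspace_add subspace_scale linear_add linear_scale)
    qed
    then show ?thesis ..
  qed
  have inj: "inj_on f N"
    using N f(1) ker eq by (simp add: linear_inj_on_iff_eq_0)
  have image: "P ` N = f ` N" using eq by simp
  have "independent (f ` B)"
    using linear_independent_injective_image[OF f(1) B(2)] inj span_B by simp
  moreover have "span (f ` B) = f ` N"
    using linear_span_image[OF f(1)] span_B by simp
  ultimately have "dim (f ` N) = card (f ` B)"
    by (metis dim_eq_card span_span)
  also have "card (f ` B) = dim N"
    using card_image[OF inj_on_subset[OF inj B(1)]] B(4) by simp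
  finally show ?thesis
    using linear_subspace_image[OF f(1) N] image by simp
qed

text \<open>
  A negative definite subspace of \<open>g + \<tau> \<otimes> \<tau>\<close> is one of \<open>g\<close>, since \<open>\<tau>(v)\<^sup>2 \<ge> 0\<close>. Conversely, the
  projection \<open>v \<mapsto> v - \<tau>(v)\<xi>\<close> onto \<open>ker \<tau>\<close> preserves \<open>g(v,v)\<close>, and it is injective on a negative
  definite subspace of \<open>g\<close>, as its kernel consists of null vectors. So both metrics have the same set
  of dimensions of negative definite subspaces.
\<close>
lemma index_bar_metric:
  assumes "symmetric_tensor A g" "one_form A \<tau>"
    and "\<xi> x \<in> radical A g x" "\<tau> x (\<xi> x) = 1"
  shows "index A (bar_metric g \<tau>) x = index A g x"
proof -
  define T where "T = tangent_space A x"
  define neg where "neg h N \<longleftrightarrow> subspace N \<and> N \<subseteq> T \<and> (\<forall>v\<in>N. v \<noteq> 0 \<longrightarrow> h x v v < 0)"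
    for h :: "'a \<Rightarrow> 'a tvec \<Rightarrow> 'a tvec \<Rightarrow> real" and N
  note T = subspace_tangent_space[of A x, folded T_def]
  have xi: "\<xi> x \<in> T" "\<And>w. w \<in> T \<Longrightarrow> g x (\<xi> x) w = 0" "\<And>w. w \<in> T \<Longrightarrow> g x w (\<xi> x) = 0"
    using assms(3) symmetric_tensor_sym[OF assms(1), of _ x] by (auto simp: radical_def T_def)
  have "neg g N" if "neg (bar_metric g \<tau>) N" for N
    using that unfolding neg_def bar_metric_def by (smt (verit) zero_le_square)
  moreover have "\<exists>N'. neg (bar_metric g \<tau>) N' \<and> dim N' = dim N" if neg: "neg g N" for N
  proof -
    define P where "P v = v - \<tau> x v *\<^sub>R \<xi> x" for v
    have N: "subspace N" "N \<subseteq> T" and neg_N: "\<And>v. v \<in> N \<Longrightarrow> v \<noteq> 0 \<Longrightarrow> g x v v < 0"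
      using neg by (auto simp: neg_def)
    have P_T: "P v \<in> T" if "v \<in> T" for v
      unfolding P_def using that xi(1) by (intro subspace_diff[OF T] subspace_scale[OF T])
    have tau_P: "\<tau> x (P v) = 0" if "v \<in> T" for v
      using that xi(1) subspace_scale[OF T xi(1)] one_form_diff[OF assms(2)]
        one_form_scaleR[OF assms(2)] assms(4)
      by (simp add: P_def T_def)
    have g_P_left: "g x (P v) w = g x v w" if "v \<in> T" "w \<in> T" for v w
      using that xi(1,2) subspace_scale[OF T xi(1)] symmetric_tensor_diff[OF assms(1)]
        symmetric_tensor_scaleR[OF assms(1)]
      by (simp add: P_def T_def)
    have g_P: "g x (P v) (P v) = g x v v" if "v \<in> T" for v
      using that P_T g_P_left symmetric_tensor_sym[OF assms(1), of _ x] by (metis T_def)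
    have ker_P: "v = 0" if v: "v \<in> N" and "P v = 0" for v
    proof (rule ccontr)
      assume "v \<noteq> 0"
      have "v = \<tau> x v *\<^sub>R \<xi> x" using \<open>P v = 0\<close> by (simp add: P_def)
      then have "g x v v = \<tau> x v * g x (\<xi> x) v"
        using symmetric_tensor_scaleR[OF assms(1), of "\<xi> x" x v "\<tau> x v"] xi(1) v N(2)
        by (auto simp: T_def)
      then show False using neg_N[OF v \<open>v \<noteq> 0\<close>] xi(2) v N(2) by auto
    qed
    have P_add: "P (u + v) = P u + P v" if "u \<in> N" "v \<in> N" for u v
    proof -
      have "\<tau> x (u + v) = \<tau> x u + \<tau> x v"
        using that N(2) by (intro one_form_add[OF assms(2)]) (auto simp: T_def)
      then show ?thesis by (simp add: P_def scaleR_add_left)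
    qed
    have P_scale: "P (c *\<^sub>R v) = c *\<^sub>R P v" if "v \<in> N" for c v
      using that N(2) one_form_scaleR[OF assms(2), of v x c]
      by (auto simp: P_def T_def scaleR_diff_right)
    have "subspace (P ` N) \<and> dim (P ` N) = dim N"
      by (rule dim_image_eq_on_subspace; fact N P_add P_scale ker_P)
    then have dim: "subspace (P ` N)" "dim (P ` N) = dim N" by simp_all
    have P_0: "P 0 = 0"
      using P_scale[of 0 0] subspace_0[OF N(1)] by simp
    have "bar_metric g \<tau> x (P v) (P v) < 0" if "v \<in> N" "P v \<noteq> 0" for v
    proof -
      have "v \<noteq> 0" using that P_0 by auto
      then show ?thesis
        using that N(2) neg_N g_P tau_P by (auto simp: bar_metric_def)
    qed
    then have "neg (bar_metric g \<tau>) (P ` N)"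
      using dim(1) P_T N(2) by (auto simp: neg_def)
    with dim(2) show ?thesis by blast
  qed
  ultimately have "{dim N |N. neg (bar_metric g \<tau>) N} = {dim N |N. neg g N}"
    by (metis (mono_tags, lifting))
  then show ?thesis by (simp add: index_def neg_def T_def)
qed


section \<open>Tensor identities for Lie and covariant derivatives\<close>

lemma connection_vector_field:
  "linear_connection A nab \<Longrightarrow> X \<in> vector_fields A \<Longrightarrow> Y \<in> vector_fields A \<Longrightarrow> nab X Y \<in> vector_fields A"
  by (simp add: linear_connection_def)

lemma torsion_free_lie_bracket:
  assumes "torsion_free A nab" "X \<in> vector_fields A" "Y \<in> vector_fields A"
  shows "lie_bracket A X Y p = nab X Y p - nab Y X p"
  using assms unfolding torsion_free_def by (metis minus_apply)

lemma cov_deriv_bar_metric: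
  assumes "smooth_manifold A" "symmetric_tensor A g" "one_form A \<tau>"
    and "X \<in> vector_fields A" "Y \<in> vector_fields A" "Z \<in> vector_fields A"
  shows "cov_deriv_tensor nab X (bar_metric g \<tau>) Y Z p = cov_deriv_tensor nab X g Y Z p
    + cov_deriv_form nab X \<tau> Y p * \<tau> p (Z p) + \<tau> p (Y p) * cov_deriv_form nab X \<tau> Z p"
proof -
  have "vapply X (\<lambda>q. g q (Y q) (Z q) + \<tau> q (Y q) * \<tau> q (Z q)) p = vapply X (\<lambda>q. g q (Y q) (Z q)) p
      + (\<tau> p (Y p) * vapply X (\<lambda>q. \<tau> q (Z q)) p + \<tau> p (Z p) * vapply X (\<lambda>q. \<tau> q (Y q)) p)"
    using assms by (simp add: vapply_add[where A = A] vapply_mult[where A = A]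
        smooth_function_mult one_form_smooth symmetric_tensor_smooth)
  then show ?thesis
    by (simp add: cov_deriv_tensor_def cov_deriv_form_def bar_metric_def algebra_simps)
qed

text \<open>
  Since \<open>\<tau>(\<xi>)\<close> is constant, Cartan's formula reads \<open>(L\<^sub>\<xi> \<tau>)(Y) = d\<tau>(\<xi>,Y)\<close>; the identity is the
  Leibniz rule for \<open>L\<^sub>\<xi>\<close> on \<open>g + \<tau> \<otimes> \<tau>\<close>.
\<close>
lemma lie_derivative_bar_metric:
  assumes "smooth_manifold A" "symmetric_tensor A g" "one_form A \<tau>"
    and "\<xi> \<in> vector_fields A" "Y \<in> vector_fields A" "Z \<in> vector_fields A"
    and "\<And>x. \<tau> x (\<xi> x) = 1"
  shows "lie_derivative A \<xi> (bar_metric g \<tau>) Y Z p = lie_derivative A \<xi> g Y Z p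
    + ext_deriv A \<tau> \<xi> Y p * \<tau> p (Z p) + \<tau> p (Y p) * ext_deriv A \<tau> \<xi> Z p"
proof -
  have "vapply \<xi> (\<lambda>q. g q (Y q) (Z q) + \<tau> q (Y q) * \<tau> q (Z q)) p = vapply \<xi> (\<lambda>q. g q (Y q) (Z q)) p
      + (\<tau> p (Y p) * vapply \<xi> (\<lambda>q. \<tau> q (Z q)) p + \<tau> p (Z p) * vapply \<xi> (\<lambda>q. \<tau> q (Y q)) p)"
    using assms by (simp add: vapply_add[where A = A] vapply_mult[where A = A]
        smooth_function_mult one_form_smooth symmetric_tensor_smooth)
  then show ?thesis
    using assms(5,6)
    by (simp add: lie_derivative_def ext_deriv_def bar_metric_def vapply_const assms(7) algebra_simps)
qed

lemma lie_derivative_torsion_free: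
  assumes "symmetric_tensor A h" "linear_connection A nab" "torsion_free A nab"
    and "\<xi> \<in> vector_fields A" "Y \<in> vector_fields A" "Z \<in> vector_fields A"
  shows "lie_derivative A \<xi> h Y Z p =
    cov_deriv_tensor nab \<xi> h Y Z p + h p (nab Y \<xi> p) (Z p) + h p (Y p) (nab Z \<xi> p)"
proof -
  note T = vector_field_at connection_vector_field[OF assms(2)]
  have *: "h p (lie_bracket A \<xi> V p) (W p) = h p (nab \<xi> V p) (W p) - h p (nab V \<xi> p) (W p)"
    if "V \<in> vector_fields A" "W \<in> vector_fields A" for V W
    using that assms by (simp add: torsion_free_lie_bracket symmetric_tensor_diff T)
  have sym: "h p (Y p) v = h p v (Y p)" if "v \<in> tangent_space A p" for v
    using that assms by (simp add: symmetric_tensor_sym T)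
  have "lie_bracket A \<xi> Z p \<in> tangent_space A p"
    using assms
    by (simp add: torsion_free_lie_bracket subspace_diff[OF subspace_tangent_space] T)
  then show ?thesis
    using assms(4-6) *[of Y Z] *[of Z Y]
    by (simp add: lie_derivative_def cov_deriv_tensor_def sym T)
qed

lemma ext_deriv_torsion_free:
  assumes "one_form A \<tau>" "linear_connection A nab" "torsion_free A nab"
    and "X \<in> vector_fields A" "Y \<in> vector_fields A"
  shows "ext_deriv A \<tau> X Y p = cov_deriv_form nab X \<tau> Y p - cov_deriv_form nab Y \<tau> X p"
  using assms
  by (simp add: ext_deriv_def cov_deriv_form_def torsion_free_lie_bracket one_form_diff
      vector_field_at connection_vector_field)


section \<open>Parallelism of \<open>g\<close> and \<open>\<tau>\<close>\<close>

lemma radical_sectionsD: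
  assumes "\<xi> \<in> radical_sections A g"
  shows "\<xi> \<in> vector_fields A" "\<xi> x \<in> radical A g x"
    "w \<in> tangent_space A x \<Longrightarrow> g x (\<xi> x) w = 0"
  using assms by (auto simp: radical_sections_def radical_def)

lemma parallel_imp_lie_derivative_radical_0:
  assumes "symmetric_tensor A g" "\<xi> \<in> radical_sections A g"
    and "linear_connection A nab" "torsion_free A nab" "parallel_tensor A nab g"
    and "Y \<in> vector_fields A" "Z \<in> vector_fields A"
  shows "lie_derivative A \<xi> g Y Z p = 0"
proof -
  note xi = radical_sectionsD[OF assms(2)]
  have nab_xi: "g p (nab V \<xi> p) (W p) = 0" if "V \<in> vector_fields A" "W \<in> vector_fields A" for V W
  proof -
    have "cov_deriv_tensor nab V g \<xi> W p = 0"
      using assms(5) that xi(1) by (simp add: parallel_tensor_def)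
    then show ?thesis
      using that xi(3) connection_vector_field[OF assms(3)]
      by (simp add: cov_deriv_tensor_def vector_field_at vapply_const)
  qed
  have "g p (Y p) (nab Z \<xi> p) = g p (nab Z \<xi> p) (Y p)"
    using assms(1,6,7) xi(1) connection_vector_field[OF assms(3)]
    by (simp add: symmetric_tensor_sym vector_field_at)
  then show ?thesis
    using lie_derivative_torsion_free[OF assms(1,3,4) xi(1) assms(6,7), of p] assms(5-7) xi(1) nab_xi
    by (simp add: parallel_tensor_def)
qed

lemma parallel_bar_metric_iff:
  assumes "smooth_manifold A" "symmetric_tensor A g" "one_form A \<tau>" "parallel_form A nab \<tau>"
  shows "parallel_tensor A nab (bar_metric g \<tau>) \<longleftrightarrow> parallel_tensor A nab g"
  using assms(4) by (simp add: parallel_tensor_def parallel_form_def cov_deriv_bar_metric[OF assms(1-3)])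

text \<open>
  The covariant derivative of \<open>\<tau>\<close> is the bilinear form \<open>h(\<nabla>\<^sub>X \<xi>, Y)\<close>, where \<open>h = g + \<tau> \<otimes> \<tau>\<close>. It is
  symmetric because \<open>\<tau>\<close> is closed and skew because \<open>\<xi>\<close> is Killing for \<open>h\<close>, so it vanishes.
\<close>
lemma levi_civita_bar_metric_imp_parallel_form:
  assumes "smooth_manifold A" "symmetric_tensor A g" "one_form A \<tau>"
    and "\<xi> \<in> radical_sections A g" "\<And>x. \<tau> x (\<xi> x) = 1"
    and lie: "\<And>Y Z p. Y \<in> vector_fields A \<Longrightarrow> Z \<in> vector_fields A \<Longrightarrow> lie_derivative A \<xi> g Y Z p = 0"
    and closed: "\<And>X Y p. X \<in> vector_fields A \<Longrightarrow> Y \<in> vector_fields A \<Longrightarrow> ext_deriv A \<tau> X Y p = 0"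
    and nab: "levi_civita A (bar_metric g \<tau>) nab"
  shows "parallel_form A nab \<tau>"
  unfolding parallel_form_def
proof (intro ballI allI)
  fix X Y p
  assume X: "X \<in> vector_fields A" and Y: "Y \<in> vector_fields A"
  let ?h = "bar_metric g \<tau>"
  have lc: "linear_connection A nab" and tf: "torsion_free A nab" and par: "parallel_tensor A nab ?h"
    using nab by (auto simp: levi_civita_def)
  note sym_h = symmetric_tensor_bar_metric[OF assms(1-3)]
  note xi = radical_sectionsD[OF assms(4)]
  have h_xi: "?h q (\<xi> q) w = \<tau> q w" if "w \<in> tangent_space A q" for q w
    using that xi(3) assms(5) by (simp add: bar_metric_def)
  have B: "cov_deriv_form nab V \<tau> W p = ?h p (nab V \<xi> p) (W p)"
    if "V \<in> vector_fields A" "W \<in> vector_fields A" for V W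
  proof -
    have "cov_deriv_tensor nab V ?h \<xi> W p = 0"
      using par that xi(1) by (simp add: parallel_tensor_def)
    then show ?thesis
      using that connection_vector_field[OF lc]
      by (simp add: cov_deriv_tensor_def cov_deriv_form_def h_xi vector_field_at)
  qed
  have symmetric: "cov_deriv_form nab X \<tau> Y p = cov_deriv_form nab Y \<tau> X p"
    using closed[OF X Y, of p] ext_deriv_torsion_free[OF assms(3) lc tf X Y, of p] by simp
  have "lie_derivative A \<xi> ?h X Y p = 0"
    using X Y xi(1)
    by (simp add: lie_derivative_bar_metric[where \<xi> = \<xi>, OF assms(1-3) _ _ _ assms(5)] lie closed)
  moreover have "cov_deriv_tensor nab \<xi> ?h X Y p = 0"
    using par X Y xi(1) by (simp add: parallel_tensor_def)
  moreover have "?h p (X p) (nab Y \<xi> p) = ?h p (nab Y \<xi> p) (X p)"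
    using symmetric_tensor_sym[OF sym_h] X Y xi(1) connection_vector_field[OF lc]
    by (simp add: vector_field_at)
  ultimately have skew: "cov_deriv_form nab X \<tau> Y p + cov_deriv_form nab Y \<tau> X p = 0"
    using lie_derivative_torsion_free[OF sym_h lc tf xi(1) X Y, of p] B X Y by simp
  show "cov_deriv_form nab X \<tau> Y p = 0"
    using symmetric skew by simp
qed

theorem proposition1p1:
  fixes A :: "('a::{t2_space, second_countable_topology}, 'e::euclidean_space) chart set"
    and g :: "'a \<Rightarrow> 'a tvec \<Rightarrow> 'a tvec \<Rightarrow> real"
    and \<xi> :: "'a vfield"
    and \<tau> :: "'a \<Rightarrow> 'a tvec \<Rightarrow> real"
  assumes lightlike: "lightlike_manifold A g"
    and nullity_1: "\<And>x. nullity_degree A g x = 1"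
    and trivial: "trivial_radical_line_bundle A g"
    and xi_section: "\<xi> \<in> radical_sections A g"
    and xi_nonzero: "\<And>x. \<xi> x \<noteq> 0"
    and tau_form: "one_form A \<tau>"
    and tau_xi: "\<And>x. \<tau> x (\<xi> x) = 1"
  shows "semi_riemannian_manifold A (bar_metric g \<tau>) \<and>
    (\<forall>nab. linear_connection A nab \<and> torsion_free A nab \<and>
        parallel_tensor A nab g \<and> parallel_form A nab \<tau> \<longrightarrow>
      (\<forall>Y\<in>vector_fields A. \<forall>Z\<in>vector_fields A. \<forall>p. lie_derivative A \<xi> g Y Z p = 0) \<and>
      (\<forall>X\<in>vector_fields A. \<forall>Y\<in>vector_fields A. \<forall>p. ext_deriv A \<tau> X Y p = 0) \<and>
      levi_civita A (bar_metric g \<tau>) nab) \<and>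
    ((\<forall>Y\<in>vector_fields A. \<forall>Z\<in>vector_fields A. \<forall>p. lie_derivative A \<xi> g Y Z p = 0) \<and>
     (\<forall>X\<in>vector_fields A. \<forall>Y\<in>vector_fields A. \<forall>p. ext_deriv A \<tau> X Y p = 0) \<longrightarrow>
      (\<forall>nab. levi_civita A (bar_metric g \<tau>) nab \<longrightarrow>
        parallel_tensor A nab g \<and> parallel_form A nab \<tau>))"
proof -
  have M: "smooth_manifold A" and sym: "symmetric_tensor A g" and idx: "\<exists>\<nu>. \<forall>x. index A g x = \<nu>"
    using lightlike by (auto simp: lightlike_manifold_def)
  note xi = radical_sectionsD[OF xi_section]
  have "semi_riemannian_manifold A (bar_metric g \<tau>)"
    unfolding semi_riemannian_manifold_def
    using M idx symmetric_tensor_bar_metric[OF M sym tau_form]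
      nondegenerate_bar_metric[where \<xi> = \<xi>, OF sym tau_form nullity_1 xi(2) xi_nonzero tau_xi]
    by (simp add: index_bar_metric[where \<xi> = \<xi>, OF sym tau_form xi(2) tau_xi])
  moreover have "lie_derivative A \<xi> g Y Z p = 0"
    if "linear_connection A nab" "torsion_free A nab" "parallel_tensor A nab g"
      and "Y \<in> vector_fields A" "Z \<in> vector_fields A" for nab Y Z p
    by (rule parallel_imp_lie_derivative_radical_0[OF sym xi_section that])
  moreover have "ext_deriv A \<tau> X Y p = 0"
    if "linear_connection A nab" "torsion_free A nab" "parallel_form A nab \<tau>"
      and "X \<in> vector_fields A" "Y \<in> vector_fields A" for nab X Y p
    using ext_deriv_torsion_free[OF tau_form that(1,2,4,5), of p] that(3-5)
    by (simp add: parallel_form_def)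
  moreover have "levi_civita A (bar_metric g \<tau>) nab"
    if "linear_connection A nab" "torsion_free A nab" "parallel_tensor A nab g" "parallel_form A nab \<tau>"
    for nab
    using that parallel_bar_metric_iff[OF M sym tau_form that(4)] by (simp add: levi_civita_def)
  moreover have "parallel_tensor A nab g \<and> parallel_form A nab \<tau>"
    if lie: "\<forall>Y\<in>vector_fields A. \<forall>Z\<in>vector_fields A. \<forall>p. lie_derivative A \<xi> g Y Z p = 0"
      and closed: "\<forall>X\<in>vector_fields A. \<forall>Y\<in>vector_fields A. \<forall>p. ext_deriv A \<tau> X Y p = 0"
      and nab: "levi_civita A (bar_metric g \<tau>) nab" for nab
  proof -
    have "parallel_form A nab \<tau>"
      using levi_civita_bar_metric_imp_parallel_form[OF M sym tau_form xi_section tau_xi _ _ nab]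
        lie closed by blast
    then show ?thesis
      using parallel_bar_metric_iff[OF M sym tau_form] nab by (simp add: levi_civita_def)
  qed
  ultimately show ?thesis by blast
qed

end
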